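(* $T\subseteq HOM\circ LT$ and $DT\subseteq HOM\circ LDT$; that is, every top-down (resp. deterministic top-down) tree transformation is a tree homomorphism followed by a linear (resp. linear deterministic) top-down tree transformation.
   Context: Alphabets are finite. A ranked alphabet $\Sigma$ is a finite set of symbols with, for each $k\ge 0$, a subset $\Sigma_k$ (symbols of rank $k$; a symbol may have several ranks), $\Sigma=\bigcup_k\Sigma_k$, only finitely many $\Sigma_k$ nonempty. $T_\Sigma$ is the set of trees over $\Sigma$: $a\in T_\Sigma$ for $a\in\Sigma_0$, and $a[t_1\cdots t_k]\in T_\Sigma$ for $k\ge1$, $a\in\Sigma_k$, $t_i\in T_\Sigma$. For a set $S$ of trees or of new symbols (regarded as having rank $0$), $T_\Sigma(S)$ is the smallest set containing $S\cup\Sigma_0$ and closed under $(t_1,\dots,t_k)\mapsto a[t_1\cdots t_k]$ for $k\ge1$, $a\in\Sigma_k$. A tree transformation from $T_\Sigma$ into $T_\Delta$ is a subset of $T_\Sigma\times T_\Delta$; maps are identified with their graphs. For $M_1\subseteq T_\Sigma\times T_\Delta$ and $M_2\subseteq T_\Delta\times T_\Omega$, $M_1\circ M_2=\{(s,t)\mid (s,u)\in M_1,(u,t)\in M_2\text{ for some }u\}$ ($M_1$ is applied first); $F\circ G=\{M_1\circ M_2\mid M_1\in F,M_2\in G\}$. Variables: $X_k=\{x_1,\dots,x_k\}$, $X_0=\emptyset$. $HOM$: a tree homomorphism is a family of maps $h_k:\Sigma_k\to T_\Delta(X_k)$ ($k\ge0$), determining $h:T_\Sigma\to T_\Delta$ by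 $h(a)=h_0(a)$ and $h(a[t_1\cdots t_k])=h_k(a)\langle x_1\gets h(t_1),\dots,x_k\gets h(t_k)\rangle$ (simultaneous substitution). A top-down finite tree transducer is $M=(Q,\Sigma,\Delta,R,Q_d)$, where $Q$ is a finite set of states, regarded as symbols of rank $1$ only and disjoint from $\Sigma\cup\Delta$, $Q_d\subseteq Q$ (initial states), and $R$ is a finite set of rules of the forms $q[a[x_1\cdots x_k]]\to t$ ($k\ge1$, $a\in\Sigma_k$, $q\in Q$, $t\in T_\Delta(Q[X_k])$, where $Q[X_k]=\{q[x]\mid q\in Q,x\in X_k\}$) or $q[a]\to t$ ($a\in\Sigma_0$, $q\in Q$, $t\in T_\Delta$). Rules rewrite trees over $Q\cup\Sigma\cup\Delta$: $s\Rightarrow s'$ if $s'$ is obtained from $s$ by replacing one occurrence of a subtree $v\langle x_1\gets\phi_1,\dots,x_k\gets\phi_k\rangle$ by $w\langle x_1\gets\phi_1,\dots,x_k\gets\phi_k\rangle$ for a rule $v\to w$ and some $\phi_i\in T_\Sigma$. $M$ realizes $\{(s,t)\in T_\Sigma\times T_\Delta\mid q[s]\Rightarrow^*t\text{ for some }q\in Q_d\}$. $M$ is linear (letter $L$) if no variable occurs more than once in the right hand side of a rule; $M$ is (partial) deterministic (letter $D$) if $Q_d$ is a singleton and different rules have different left hand sides. $T$, $DT$, $LT$, $LDT$ are the classes of tree transformations realized by top-down finite tree transducers with the indicated properties. *)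

theory Defs
  imports Main
begin

text \<open>
  All symbols (of input, output and intermediate alphabets, and states) are drawn from one
  arbitrary type \<open>'a\<close>, so that each class of tree transformations is a set of relations over a
  single type of trees; for infinite \<open>'a\<close> this is no restriction up to renaming of symbols. A ranked alphabet is given by its set of pairs (symbol, rank): a symbol
  may have several ranks, and finitely many symbols with finitely many nonempty \<open>\<Sigma>\<^sub>k\<close> means
  exactly that this set of pairs is finite. The variables \<open>x\<^sub>1, x\<^sub>2, \<dots>\<close> are the trees \<open>Var 1\<close>,
  \<open>Var 2\<close> and so on; as they have their own constructor they are distinct from all symbols.
\<close>

datatype 'a tree = Var nat | Node 'a "'a tree list"

type_synonym 'a ranked = "('a \<times> nat) set"

definition ranked_alphabet :: "'a ranked \<Rightarrow> bool" where
  "ranked_alphabet \<Sigma> \<longleftrightarrow> finite \<Sigma>"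

definition symbols :: "'a ranked \<Rightarrow> 'a set" where
  "symbols \<Sigma> = fst ` \<Sigma>"

text \<open>\<open>trees_over \<Sigma> S\<close> is \<open>T\<^sub>\<Sigma>(S)\<close>.\<close>

inductive_set trees_over :: "'a ranked \<Rightarrow> 'a tree set \<Rightarrow> 'a tree set"
  for \<Sigma> :: "'a ranked" and S :: "'a tree set" where
  base: "t \<in> S \<Longrightarrow> t \<in> trees_over \<Sigma> S"
| leaf: "(a, 0) \<in> \<Sigma> \<Longrightarrow> Node a [] \<in> trees_over \<Sigma> S"
| node: "\<lbrakk>(a, k) \<in> \<Sigma>; k \<ge> 1; length ts = k; \<And>t. t \<in> set ts \<Longrightarrow> t \<in> trees_over \<Sigma> S\<rbrakk>
         \<Longrightarrow> Node a ts \<in> trees_over \<Sigma> S"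

abbreviation trees :: "'a ranked \<Rightarrow> 'a tree set" where
  "trees \<Sigma> \<equiv> trees_over \<Sigma> {}"

definition X :: "nat \<Rightarrow> 'a tree set" where
  "X k = Var ` {1..k}"

text \<open>\<open>subst [s\<^sub>1, \<dots>, s\<^sub>k] t\<close> is the simultaneous substitution
  \<open>t\<langle>x\<^sub>1 \<leftarrow> s\<^sub>1, \<dots>, x\<^sub>k \<leftarrow> s\<^sub>k\<rangle>\<close>; list positions count from 0, variables from 1.\<close>

fun subst :: "'a tree list \<Rightarrow> 'a tree \<Rightarrow> 'a tree" where
  "subst ss (Var i) = (if 1 \<le> i \<and> i \<le> length ss then ss ! (i - 1) else Var i)"
| "subst ss (Node a ts) = Node a (map (subst ss) ts)"

text \<open>The number of occurrences of the variable \<open>x\<^sub>i\<close> in a tree.\<close>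

fun var_count :: "nat \<Rightarrow> 'a tree \<Rightarrow> nat" where
  "var_count i (Var j) = (if i = j then 1 else 0)"
| "var_count i (Node a ts) = sum_list (map (var_count i) ts)"

type_synonym 'a transformation = "('a tree \<times> 'a tree) set"


text \<open>A tree homomorphism is a family \<open>h k :: \<Sigma>\<^sub>k \<rightarrow> T\<^sub>\<Delta>(X\<^sub>k)\<close>; the values of \<open>h k\<close> outside
  \<open>\<Sigma>\<^sub>k\<close> are irrelevant for its action on \<open>T\<^sub>\<Sigma>\<close>.\<close>

definition tree_hom :: "'a ranked \<Rightarrow> 'a ranked \<Rightarrow> (nat \<Rightarrow> 'a \<Rightarrow> 'a tree) \<Rightarrow> bool" where
  "tree_hom \<Sigma> \<Delta> h \<longleftrightarrow> (\<forall>(a, k) \<in> \<Sigma>. h k a \<in> trees_over \<Delta> (X k))"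

fun hom_apply :: "(nat \<Rightarrow> 'a \<Rightarrow> 'a tree) \<Rightarrow> 'a tree \<Rightarrow> 'a tree" where
  "hom_apply h (Var i) = Var i"
| "hom_apply h (Node a ts) = subst (map (hom_apply h) ts) (h (length ts) a)"

definition HOM :: "'a transformation set" where
  "HOM = {{(s, hom_apply h s) | s. s \<in> trees \<Sigma>} | \<Sigma> \<Delta> h.
            ranked_alphabet \<Sigma> \<and> ranked_alphabet \<Delta> \<and> tree_hom \<Sigma> \<Delta> h}"


text \<open>A rule \<open>v \<rightarrow> w\<close> is the pair \<open>(v, w)\<close>.\<close>

record 'a transducer =
  states :: "'a set"
  in_alph :: "'a ranked"
  out_alph :: "'a ranked"
  rules :: "('a tree \<times> 'a tree) set"
  initial :: "'a set"

definition lhs :: "'a \<Rightarrow> 'a \<Rightarrow> nat \<Rightarrow> 'a tree" where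
  "lhs q a k = Node q [Node a (map Var [1..<Suc k])]"

definition state_vars :: "'a set \<Rightarrow> nat \<Rightarrow> 'a tree set" where
  "state_vars Q k = {Node q [x] | q x. q \<in> Q \<and> x \<in> X k}"

text \<open>The two forms of rules are treated uniformly: for \<open>k = 0\<close>, \<open>lhs q a k\<close> is \<open>q[a]\<close> and
  \<open>state_vars Q k\<close>, i.e. \<open>Q[X\<^sub>k]\<close>, is empty, so the right hand side is in \<open>T\<^sub>\<Delta>\<close>.\<close>

definition top_down :: "'a transducer \<Rightarrow> bool" where
  "top_down M \<longleftrightarrow>
     finite (states M) \<and> ranked_alphabet (in_alph M) \<and> ranked_alphabet (out_alph M) \<and>
     states M \<inter> (symbols (in_alph M) \<union> symbols (out_alph M)) = {} \<and>
     initial M \<subseteq> states M \<and> finite (rules M) \<and>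
     (\<forall>r \<in> rules M. \<exists>q a k w. r = (lhs q a k, w) \<and> q \<in> states M \<and> (a, k) \<in> in_alph M \<and>
        w \<in> trees_over (out_alph M) (state_vars (states M) k))"

inductive step :: "'a transducer \<Rightarrow> 'a tree \<Rightarrow> 'a tree \<Rightarrow> bool" for M :: "'a transducer" where
  rule: "\<lbrakk>(lhs q a k, w) \<in> rules M; length \<phi> = k; set \<phi> \<subseteq> trees (in_alph M)\<rbrakk>
         \<Longrightarrow> step M (subst \<phi> (lhs q a k)) (subst \<phi> w)"
| ctxt: "step M s s' \<Longrightarrow> step M (Node b (us @ s # vs)) (Node b (us @ s' # vs))"

definition realizes :: "'a transducer \<Rightarrow> 'a transformation" where
  "realizes M = {(s, t). s \<in> trees (in_alph M) \<and> t \<in> trees (out_alph M) \<and>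
                   (\<exists>q \<in> initial M. (step M)\<^sup>*\<^sup>* (Node q [s]) t)}"

definition linear :: "'a transducer \<Rightarrow> bool" where
  "linear M \<longleftrightarrow> (\<forall>(v, w) \<in> rules M. \<forall>i. var_count i w \<le> 1)"

definition deterministic :: "'a transducer \<Rightarrow> bool" where
  "deterministic M \<longleftrightarrow> (\<exists>q. initial M = {q}) \<and>
     (\<forall>r \<in> rules M. \<forall>r' \<in> rules M. r \<noteq> r' \<longrightarrow> fst r \<noteq> fst r')"

definition class_T :: "'a transformation set" where
  "class_T = {realizes M | M. top_down M}"

definition class_DT :: "'a transformation set" where
  "class_DT = {realizes M | M. top_down M \<and> deterministic M}"

definition class_LT :: "'a transformation set" where
  "class_LT = {realizes M | M. top_down M \<and> linear M}"

definition class_LDT :: "'a transformation set" where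
  "class_LDT = {realizes M | M. top_down M \<and> linear M \<and> deterministic M}"

text \<open>The library's \<open>M\<^sub>1 O M\<^sub>2\<close> applies \<open>M\<^sub>1\<close> first, as required here.\<close>

definition class_comp ::
    "'a transformation set \<Rightarrow> 'a transformation set \<Rightarrow> 'a transformation set"
    (infixr "\<circ>\<^sub>c" 75) where
  "F \<circ>\<^sub>c G = {M1 O M2 | M1 M2. M1 \<in> F \<and> M2 \<in> G}"

end

theory Submission
  imports Defs
begin

text \<open>
  Choose \<open>n \<ge> 1\<close> bounding the number of variable occurrences in every right hand side of \<open>M\<close>.
  The homomorphism makes \<open>n\<close> copies of the list of subtrees of each node, keeping its label, so
  that a symbol \<open>a\<close> of rank \<open>k\<close> becomes the symbol \<open>a\<close> of rank \<open>n k\<close>; as \<open>n \<ge> 1\<close>, the pair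
  \<open>(a, k)\<close> is recovered from \<open>(a, n k)\<close>. In a right hand side, the variable occurrence number
  \<open>c\<close> (counting from 0, left to right) then reads the copy number \<open>c\<close>, i.e. \<open>x\<^sub>i\<close> is replaced
  there by the variable with index \<open>c k + i\<close>. The resulting transducer is linear, and applying the
  homomorphism below the states of a sentential form is a bisimulation between both rewrite
  relations.
\<close>

section \<open>Linear rules and the copying homomorphism\<close>

fun num_vars :: "'a tree \<Rightarrow> nat" where
  "num_vars (Var i) = 1"
| "num_vars (Node a ts) = sum_list (map num_vars ts)"

text \<open>The argument \<open>c\<close> is the number of variable occurrences already passed to
  the left. It has to be threaded through the children of a node, hence the mutual recursion with a
  list version.\<close>

fun linearize :: "nat \<Rightarrow> nat \<Rightarrow> 'a tree \<Rightarrow> 'a tree"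
  and linearize_list :: "nat \<Rightarrow> nat \<Rightarrow> 'a tree list \<Rightarrow> 'a tree list" where
  "linearize k c (Var i) = Var (c * k + i)"
| "linearize k c (Node a ts) = Node a (linearize_list k c ts)"
| "linearize_list k c [] = []"
| "linearize_list k c (t # ts) = linearize k c t # linearize_list k (c + num_vars t) ts"

definition copies :: "nat \<Rightarrow> 'b list \<Rightarrow> 'b list" where
  "copies n xs = concat (replicate n xs)"

definition copy_hom :: "nat \<Rightarrow> nat \<Rightarrow> 'a \<Rightarrow> 'a tree" where
  "copy_hom n k a = Node a (map Var (copies n [1..<Suc k]))"

definition copy_alph :: "nat \<Rightarrow> 'a ranked \<Rightarrow> 'a ranked" where
  "copy_alph n \<Sigma> = (\<lambda>(a, k). (a, n * k)) ` \<Sigma>"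

definition linear_rules :: "nat \<Rightarrow> ('a tree \<times> 'a tree) set \<Rightarrow> ('a tree \<times> 'a tree) set" where
  "linear_rules n R = {(lhs q a (n * k), linearize k 0 w) | q a k w. (lhs q a k, w) \<in> R}"

definition linear_transducer :: "nat \<Rightarrow> 'a transducer \<Rightarrow> 'a transducer" where
  "linear_transducer n M = \<lparr>states = states M, in_alph = copy_alph n (in_alph M),
     out_alph = out_alph M, rules = linear_rules n (rules M), initial = initial M\<rparr>"

text \<open>These are the unfinished parts of a derivation: a sentential form is an output tree
  whose leaves may also be such states applied to unread input trees.\<close>

definition configs :: "'a set \<Rightarrow> 'a ranked \<Rightarrow> 'a tree set" where
  "configs Q \<Sigma> = {Node q [s] | q s. q \<in> Q \<and> s \<in> trees \<Sigma>}"

text \<open>The recursion stops at the topmost states, so \<open>f\<close> acts on unread input only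
  and the output produced so far is left alone.\<close>

fun below_states :: "'a set \<Rightarrow> ('a tree \<Rightarrow> 'a tree) \<Rightarrow> 'a tree \<Rightarrow> 'a tree" where
  "below_states Q f (Var i) = Var i"
| "below_states Q f (Node a ts) =
     (if a \<in> Q then Node a (map f ts) else Node a (map (below_states Q f) ts))"

section \<open>Lists of copies, left hand sides and trees\<close>

lemma length_copies [simp]: "length (copies n xs) = n * length xs"
  by (simp add: copies_def length_concat sum_list_replicate)

lemma set_copies_subset: "set (copies n xs) \<subseteq> set xs"
  by (auto simp: copies_def)

lemma map_copies: "map f (copies n xs) = copies n (map f xs)"
  by (simp add: copies_def map_concat map_replicate)

lemma nth_copies:
  assumes "c < n" "i < length xs"
  shows "copies n xs ! (c * length xs + i) = xs ! i"
  using assms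
proof (induction n arbitrary: c)
  case (Suc n)
  then show ?case
    by (cases c) (auto simp: copies_def nth_append)
qed simp

lemma lhs_eq_iff: "lhs q a k = lhs q' a' k' \<longleftrightarrow> q = q' \<and> a = a' \<and> k = k'"
proof
  assume eq: "lhs q a k = lhs q' a' k'"
  then have "map Var [1..<Suc k] = (map Var [1..<Suc k'] :: 'a tree list)"
    by (simp add: lhs_def del: upt_Suc)
  from arg_cong[OF this, of length] have "k = k'"
    by (simp del: upt_Suc)
  with eq show "q = q' \<and> a = a' \<and> k = k'"
    by (simp add: lhs_def del: upt_Suc)
qed simp

lemma subst_vars: "length ss = k \<Longrightarrow> map (subst ss) (map Var [1..<Suc k]) = ss"
  by (rule nth_equalityI) (simp_all del: upt_Suc)

lemma subst_lhs: "length ss = k \<Longrightarrow> subst ss (lhs q a k) = Node q [Node a ss]"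
  using subst_vars[of ss k] by (simp add: lhs_def del: upt_Suc)

lemma trees_over_nodeI:
  assumes "(a, length ts) \<in> \<Sigma>" "\<And>t. t \<in> set ts \<Longrightarrow> t \<in> trees_over \<Sigma> S"
  shows "Node a ts \<in> trees_over \<Sigma> S"
proof (cases ts)
  case Nil
  with assms show ?thesis
    by (auto intro: trees_over.leaf)
next
  case (Cons u us)
  with assms show ?thesis
    by (intro trees_over.node[of a "length ts"]) auto
qed

lemma trees_over_induct [consumes 1, case_names base node]:
  assumes "t \<in> trees_over \<Sigma> S"
    and "\<And>t. t \<in> S \<Longrightarrow> P t"
    and "\<And>a ts. \<lbrakk>(a, length ts) \<in> \<Sigma>; \<And>t. t \<in> set ts \<Longrightarrow> t \<in> trees_over \<Sigma> S;
           \<And>t. t \<in> set ts \<Longrightarrow> P t\<rbrakk> \<Longrightarrow> P (Node a ts)"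
  shows "P t"
  using assms(1) by induction (use assms(2) assms(3)[of _ "[]"] assms(3) in auto)

lemma treesD:
  assumes "Node a ts \<in> trees \<Sigma>"
  shows "(a, length ts) \<in> \<Sigma>" "\<And>t. t \<in> set ts \<Longrightarrow> t \<in> trees \<Sigma>"
  using assms by (auto elim: trees_over.cases)

lemma symbolsI: "(a, k) \<in> \<Sigma> \<Longrightarrow> a \<in> symbols \<Sigma>"
  by (force simp: symbols_def)

lemma symbols_copy_alph [simp]: "symbols (copy_alph n \<Sigma>) = symbols \<Sigma>"
  by (force simp: symbols_def copy_alph_def)

section \<open>Copying as a tree homomorphism\<close>

lemma hom_apply_copy_hom [simp]:
  "hom_apply (copy_hom n) (Node a ts) = Node a (copies n (map (hom_apply (copy_hom n)) ts))"
  using subst_vars[of "map (hom_apply (copy_hom n)) ts" "length ts"]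
  by (simp add: copy_hom_def map_copies comp_def del: upt_Suc)

declare hom_apply.simps(2) [simp del]

lemma hom_apply_copy_hom_trees:
  "s \<in> trees \<Sigma> \<Longrightarrow> hom_apply (copy_hom n) s \<in> trees (copy_alph n \<Sigma>)"
proof (induction rule: trees_over_induct)
  case (node a ts)
  then show ?case
    using set_copies_subset[of n "map (hom_apply (copy_hom n)) ts"]
    by (fastforce simp: copy_alph_def intro!: trees_over_nodeI)
qed simp

lemma tree_hom_copy_hom: "tree_hom \<Sigma> (copy_alph n \<Sigma>) (copy_hom n)"
  using set_copies_subset
  by (fastforce simp: tree_hom_def copy_hom_def X_def copy_alph_def simp del: upt_Suc
      intro!: trees_over_nodeI intro: trees_over.base)

section \<open>Linear right hand sides\<close>

lemma length_linearize_list [simp]: "length (linearize_list k c ts) = length ts"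
  by (induction ts arbitrary: c) auto

text \<open>Each child starts with its own counter; the bound passes a hypothesis
  \<open>c + num_vars w \<le> n\<close> on from a node to its children.\<close>

lemma set_linearize_list:
  "t' \<in> set (linearize_list k c ts) \<Longrightarrow>
   \<exists>t \<in> set ts. \<exists>c'. t' = linearize k c' t \<and> c' + num_vars t \<le> c + sum_list (map num_vars ts)"
proof (induction ts arbitrary: c)
  case (Cons t ts)
  then show ?case
    by (fastforce simp: add.assoc)
qed simp

lemma linearize_trees_over:
  assumes "w \<in> trees_over \<Delta> (state_vars Q k)" "c + num_vars w \<le> n"
  shows "linearize k c w \<in> trees_over \<Delta> (state_vars Q (n * k))"
  using assms
proof (induction arbitrary: c rule: trees_over_induct)
  case (base w)
  then obtain q i where w: "w = Node q [Var i]" "q \<in> Q" "1 \<le> i" "i \<le> k"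
    by (auto simp: state_vars_def X_def)
  \<comment> \<open>The tree \<open>w\<close> has one variable occurrence, so \<open>c < n\<close>;
    together with \<open>i \<le> k\<close> this puts the new index \<open>c * k + i\<close> within
    \<open>n * k\<close>.\<close>
  have "Suc c * k \<le> n * k"
    using base w by (intro mult_le_mono1) auto
  with w show ?case
    by (intro trees_over.base) (auto simp: state_vars_def X_def)
next
  case (node a ts)
  then show ?case
    by (fastforce intro!: trees_over_nodeI dest!: set_linearize_list)
qed

text \<open>Linearity needs only the bound 1, but the induction needs to know where the indices lie:
  those of a subtree fall into a half-open interval determined by its counter, and the intervals of
  successive siblings are adjacent and disjoint.\<close>

lemma var_count_linearize:
  assumes "w \<in> trees_over \<Delta> (state_vars Q k)"
  shows "var_count j (linearize k c w) \<le>
    (if c * k < j \<and> j \<le> (c + num_vars w) * k then 1 else 0)"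
  using assms
proof (induction arbitrary: c rule: trees_over_induct)
  case (base w)
  then show ?case
    by (auto simp: state_vars_def X_def)
next
  case (node a ts)
  have "sum_list (map (var_count j) (linearize_list k c ts)) \<le>
    (if c * k < j \<and> j \<le> (c + sum_list (map num_vars ts)) * k then 1 else 0)"
    using node(3)
  proof (induction ts arbitrary: c)
    case (Cons t ts)
    have "var_count j (linearize k c t) \<le>
        (if c * k < j \<and> j \<le> (c + num_vars t) * k then 1 else 0)"
      using Cons.prems by simp
    moreover have "sum_list (map (var_count j) (linearize_list k (c + num_vars t) ts)) \<le>
        (if (c + num_vars t) * k < j \<and> j \<le> (c + num_vars t + sum_list (map num_vars ts)) * k
         then 1 else 0)"
      using Cons by (metis list.set_intros(2))
    moreover have "c * k \<le> (c + num_vars t) * k"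
      "(c + num_vars t) * k \<le> (c + num_vars t + sum_list (map num_vars ts)) * k"
      by (simp_all add: mult_le_mono1)
    \<comment> \<open>The index \<open>j\<close> lies in at most one of the intervals belonging to
      \<open>t\<close> and to \<open>ts\<close>, so at most one summand is 1.\<close>
    ultimately have "var_count j (linearize k c t) +
        sum_list (map (var_count j) (linearize_list k (c + num_vars t) ts)) \<le>
        (if c * k < j \<and> j \<le> (c + num_vars t + sum_list (map num_vars ts)) * k then 1 else 0)"
      by (smt (verit) add_0 add_0_right le_trans not_le le_zero_eq less_le_trans)
    then show ?case
      by (simp add: add.assoc)
  qed simp
  then show ?case
    by simp
qed

section \<open>Sentential forms\<close>

lemma subst_configs:
  assumes "w \<in> trees_over \<Delta> (state_vars Q k)" "length \<phi> = k" "set \<phi> \<subseteq> trees \<Sigma>"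
  shows "subst \<phi> w \<in> trees_over \<Delta> (configs Q \<Sigma>)"
  using assms
proof (induction rule: trees_over_induct)
  case (base w)
  then obtain q i where "w = Node q [Var i]" "q \<in> Q" "1 \<le> i" "i \<le> k"
    by (auto simp: state_vars_def X_def)
  with base show ?case
    by (intro trees_over.base) (auto simp: configs_def subset_iff)
next
  case (node a ts)
  then show ?case
    by (auto intro!: trees_over_nodeI)
qed

text \<open>The core of the simulation: occurrence number \<open>c\<close> of a variable finds in
  copy number \<open>c\<close> the same converted subtree that the original rule would have read
  there. Since variables of \<open>w\<close> occur only below states, \<open>f\<close> reaches every
  substituted tree.\<close>

lemma below_states_subst:
  assumes "w \<in> trees_over \<Delta> (state_vars Q k)" "length \<phi> = k" "Q \<inter> symbols \<Delta> = {}"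
    "c + num_vars w \<le> n"
  shows "below_states Q f (subst \<phi> w) = subst (copies n (map f \<phi>)) (linearize k c w)"
  using assms
proof (induction arbitrary: c rule: trees_over_induct)
  case (base w)
  then obtain q i where w: "w = Node q [Var i]" "q \<in> Q" "1 \<le> i" "i \<le> k"
    by (auto simp: state_vars_def X_def)
  have c: "c < n"
    using base w by auto
  have "Suc c * k \<le> n * k"
    using c by (intro mult_le_mono1) auto
  \<comment> \<open>Copies and list positions count from 0, variables from 1, which explains
    \<open>i - 1\<close>.\<close>
  moreover have "copies n (map f \<phi>) ! (c * k + (i - 1)) = f (\<phi> ! (i - 1))"
    using nth_copies[OF c, of "i - 1" "map f \<phi>"] w base by simp
  ultimately show ?case
    using w base by simp
next
  case (node a ts)
  have "map (\<lambda>t. below_states Q f (subst \<phi> t)) ts =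
      map (subst (copies n (map f \<phi>))) (linearize_list k c ts)"
    if "c + sum_list (map num_vars ts) \<le> n"
    using node(3) that
  proof (induction ts arbitrary: c)
    case (Cons t ts)
    have "below_states Q f (subst \<phi> t) = subst (copies n (map f \<phi>)) (linearize k c t)"
      using Cons.prems node.prems by simp
    moreover have "map (\<lambda>t. below_states Q f (subst \<phi> t)) ts =
        map (subst (copies n (map f \<phi>))) (linearize_list k (c + num_vars t) ts)"
      using Cons.prems by (intro Cons.IH) auto
    ultimately show ?case
      by simp
  qed simp
  moreover have "a \<notin> Q"
    using node symbolsI by fast
  ultimately show ?case
    using node.prems by (simp add: comp_def)
qed

lemma below_states_trees:
  "t \<in> trees \<Delta> \<Longrightarrow> Q \<inter> symbols \<Delta> = {} \<Longrightarrow> below_states Q f t = t"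
  by (induction rule: trees_over_induct) (auto dest: symbolsI intro: map_idI)

text \<open>The conversion erases no state, so a state-free image leaves no room for a configuration
  in \<open>u\<close>.\<close>

lemma trees_if_below_states_trees:
  assumes "u \<in> trees_over \<Delta> (configs Q \<Sigma>)" "below_states Q f u \<in> trees \<Delta>"
    "Q \<inter> symbols \<Delta> = {}"
  shows "u \<in> trees \<Delta>"
  using assms
proof (induction rule: trees_over_induct)
  case (base u)
  then show ?case
    by (auto simp: configs_def dest!: treesD(1) symbolsI)
next
  case (node a ts)
  then have "a \<notin> Q"
    using symbolsI by fast
  with node.prems have "Node a (map (below_states Q f) ts) \<in> trees \<Delta>"
    by simp
  then have "below_states Q f t \<in> trees \<Delta>" if "t \<in> set ts" for t
    using that by (auto intro: treesD(2))
  with node show ?case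
    by (auto intro!: trees_over_nodeI)
qed

section \<open>Single rewrite steps\<close>

lemma step_Node_cases:
  assumes "step M (Node b ts) v"
  obtains (root) a k w \<phi> where "ts = [Node a \<phi>]" "(lhs b a k, w) \<in> rules M" "length \<phi> = k"
      "set \<phi> \<subseteq> trees (in_alph M)" "v = subst \<phi> w"
    | (inner) us s s' vs where "ts = us @ s # vs" "step M s s'" "v = Node b (us @ s' # vs)"
  using assms
proof cases
  case (rule q a k w \<phi>)
  then show thesis
    using root by (simp add: subst_lhs)
next
  case (ctxt s s' us vs)
  then show thesis
    using inner by blast
qed

lemma top_downD:
  assumes "top_down M" "(lhs q a k, w) \<in> rules M"
  shows "q \<in> states M" "(a, k) \<in> in_alph M"
    "w \<in> trees_over (out_alph M) (state_vars (states M) k)"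
  using assms by (fastforce simp: top_down_def lhs_eq_iff)+

text \<open>Every rule has a state at the root of its left hand side. This later rules out steps
  inside the unread input below a state.\<close>

lemma no_step_trees:
  assumes "s \<in> trees \<Sigma>" "states M \<inter> symbols \<Sigma> = {}" "top_down M"
  shows "\<not> step M s s'"
  using assms
proof (induction arbitrary: s' rule: trees_over_induct)
  case (node a ts)
  have "a \<notin> states M"
    using node symbolsI by fast
  show ?case
  proof
    assume "step M (Node a ts) s'"
    then show False
    proof (cases rule: step_Node_cases)
      case (root b k w \<phi>)
      with \<open>a \<notin> states M\<close> node.prems show ?thesis
        by (auto dest: top_downD)
    next
      case (inner us t t' vs)
      with node show ?thesis
        by auto
    qed
  qed
qed simp

section \<open>Bisimulation between a transducer and its linear version\<close>

locale copying =
  fixes M :: "'a transducer" and n :: nat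
  assumes top_down_M: "top_down M"
    and n_pos: "n \<ge> 1"
    and num_vars_le: "(v, w) \<in> rules M \<Longrightarrow> num_vars w \<le> n"
begin

abbreviation M' :: "'a transducer" where
  "M' \<equiv> linear_transducer n M"

abbreviation hom :: "'a tree \<Rightarrow> 'a tree" where
  "hom \<equiv> hom_apply (copy_hom n)"

abbreviation sentential :: "'a tree set" where
  "sentential \<equiv> trees_over (out_alph M) (configs (states M) (in_alph M))"

abbreviation convert :: "'a tree \<Rightarrow> 'a tree" where
  "convert \<equiv> below_states (states M) hom"

lemma M'_simps [simp]:
  "states M' = states M" "in_alph M' = copy_alph n (in_alph M)" "out_alph M' = out_alph M"
  "rules M' = linear_rules n (rules M)" "initial M' = initial M"
  by (simp_all add: linear_transducer_def)

lemma disjoint: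
  "states M \<inter> symbols (in_alph M) = {}" "states M \<inter> symbols (out_alph M) = {}"
  using top_down_M by (auto simp: top_down_def)

lemma linear_rulesE:
  assumes "r \<in> linear_rules n (rules M)"
  obtains q a k w where "r = (lhs q a (n * k), linearize k 0 w)" "(lhs q a k, w) \<in> rules M"
    "q \<in> states M" "(a, k) \<in> in_alph M"
    "w \<in> trees_over (out_alph M) (state_vars (states M) k)"
  using assms top_down_M by (fastforce simp: linear_rules_def dest: top_downD)

lemma top_down_M': "top_down M'"
proof -
  \<comment> \<open>The new rules are the image of the old ones under a function that reads the rank
    off the left hand side; this gives finiteness.\<close>
  let ?g = "\<lambda>(v, w). case v of
    Node q [Node a xs] \<Rightarrow> (lhs q a (n * length xs), linearize (length xs) 0 w)"
  have "linear_rules n (rules M) \<subseteq> ?g ` rules M"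
  proof
    fix r
    assume "r \<in> linear_rules n (rules M)"
    then obtain q a k w where "r = (lhs q a (n * k), linearize k 0 w)" "(lhs q a k, w) \<in> rules M"
      by (rule linear_rulesE)
    then have "r = ?g (lhs q a k, w)" "(lhs q a k, w) \<in> rules M"
      by (simp_all add: lhs_def del: upt_Suc)
    then show "r \<in> ?g ` rules M"
      by blast
  qed
  then have "finite (linear_rules n (rules M))"
    using top_down_M finite_subset by (auto simp: top_down_def)
  moreover have "\<exists>q a k w. r = (lhs q a k, w) \<and> q \<in> states M \<and> (a, k) \<in> copy_alph n (in_alph M) \<and>
      w \<in> trees_over (out_alph M) (state_vars (states M) k)"
    if "r \<in> linear_rules n (rules M)" for r
    using that
  proof (rule linear_rulesE)
    fix q a k w
    assume "r = (lhs q a (n * k), linearize k 0 w)" "(lhs q a k, w) \<in> rules M"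
      "q \<in> states M" "(a, k) \<in> in_alph M" "w \<in> trees_over (out_alph M) (state_vars (states M) k)"
    then show ?thesis
      using linearize_trees_over[of w "out_alph M" "states M" k 0 n] num_vars_le
      by (intro exI[of _ q] exI[of _ a] exI[of _ "n * k"] exI[of _ "linearize k 0 w"])
        (force simp: copy_alph_def)
  qed
  moreover have "finite (copy_alph n (in_alph M))"
    using top_down_M by (simp add: top_down_def ranked_alphabet_def copy_alph_def)
  ultimately show ?thesis
    using top_down_M by (simp add: top_down_def ranked_alphabet_def)
qed

lemma linear_M': "linear M'"
  unfolding linear_def
proof (intro ballI, clarify)
  fix v w i
  assume "(v, w) \<in> rules M'"
  then have "(v, w) \<in> linear_rules n (rules M)"
    by simp
  then obtain k w0 where "w = linearize k 0 w0"
    "w0 \<in> trees_over (out_alph M) (state_vars (states M) k)"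
    by (rule linear_rulesE) auto
  then show "var_count i w \<le> 1"
    using var_count_linearize[of w0 "out_alph M" "states M" k i 0] by (auto split: if_splits)
qed

text \<open>As \<open>n \<ge> 1\<close>, equal ranks \<open>n * k\<close> and \<open>n * k'\<close>
  give \<open>k = k'\<close>. Hence rules with equal new left hand sides stem from rules with equal
  old ones, that is, from the same rule.\<close>

lemma deterministic_M': "deterministic M \<Longrightarrow> deterministic M'"
  using n_pos by (fastforce simp: deterministic_def lhs_eq_iff elim!: linear_rulesE)

lemma root_rewrite:
  assumes "(lhs q a k, w) \<in> rules M" "length \<phi> = k"
  shows "convert (subst \<phi> w) = subst (copies n (map hom \<phi>)) (linearize k 0 w)"
  using assms top_down_M disjoint(2) num_vars_le
  by (intro below_states_subst[of _ "out_alph M"]) (auto dest: top_downD)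

lemma step_forward:
  assumes "u \<in> sentential" "step M u v"
  shows "v \<in> sentential \<and> step M' (convert u) (convert v)"
  using assms
proof (induction arbitrary: v rule: trees_over_induct)
  case (base u)
  then obtain q s where u: "u = Node q [s]" "q \<in> states M" "s \<in> trees (in_alph M)"
    by (auto simp: configs_def)
  from base.prems[unfolded u(1)] show ?case
  proof (cases rule: step_Node_cases)
    case (root a k w \<phi>)
    let ?\<phi> = "copies n (map hom \<phi>)"
    have "v \<in> sentential"
      using root top_down_M by (auto intro: subst_configs dest: top_downD)
    moreover have "step M' (subst ?\<phi> (lhs q a (n * k))) (subst ?\<phi> (linearize k 0 w))"
    proof (rule step.rule)
      show "(lhs q a (n * k), linearize k 0 w) \<in> rules M'"
        using root by (auto simp: linear_rules_def)
      show "set ?\<phi> \<subseteq> trees (in_alph M')"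
        using root hom_apply_copy_hom_trees set_copies_subset[of n "map hom \<phi>"] by fastforce
    qed (use root in simp)
    ultimately show ?thesis
      using u root root_rewrite by (simp add: subst_lhs)
  next
    case (inner us t t' vs)
    \<comment> \<open>A step not at the root would have to rewrite the input tree \<open>s\<close>
      itself.\<close>
    then have "us = []" "vs = []" "t = s"
      by (auto simp: Cons_eq_append_conv)
    then show ?thesis
      using inner no_step_trees[OF u(3) disjoint(1) top_down_M] by simp
  qed
next
  case (node a ts)
  have a: "a \<notin> states M"
    using node(1) disjoint(2) symbolsI by fast
  from node.prems show ?case
  proof (cases rule: step_Node_cases)
    case (root b k w \<phi>)
    then show ?thesis
      using a top_down_M by (auto dest: top_downD)
  next
    case (inner us t t' vs)
    then have t: "t' \<in> sentential" "step M' (convert t) (convert t')"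
      using node by auto
    then have "v \<in> sentential"
      using node inner by (auto intro!: trees_over_nodeI)
    with t inner a show ?thesis
      by (simp add: step.ctxt)
  qed
qed

text \<open>The rule of \<open>M'\<close> used at a state reveals a rule of \<open>M\<close> for the
  same state and symbol; it remains to see that its rank is the one found in the unconverted
  tree.\<close>

lemma step_backward:
  assumes "u \<in> sentential" "step M' (convert u) v'"
  shows "\<exists>v. v' = convert v \<and> step M u v"
  using assms
proof (induction arbitrary: v' rule: trees_over_induct)
  case (base u)
  then obtain q s where u: "u = Node q [s]" "q \<in> states M" "s \<in> trees (in_alph M)"
    by (auto simp: configs_def)
  then have "step M' (Node q [hom s]) v'"
    using base by simp
  then show ?case
  proof (cases rule: step_Node_cases)
    case (root a k' w' \<phi>')
    obtain \<phi> where \<phi>: "s = Node a \<phi>" "\<phi>' = copies n (map hom \<phi>)"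
      using root(1) u(3) by (cases s) (auto elim: trees_over.cases)
    from root(2) have "(lhs q a k', w') \<in> linear_rules n (rules M)"
      by simp
    then obtain k w where w: "k' = n * k" "w' = linearize k 0 w" "(lhs q a k, w) \<in> rules M"
      by (rule linear_rulesE) (auto simp: lhs_eq_iff)
    \<comment> \<open>Both \<open>n * length \<phi>\<close> and \<open>n * k\<close> are the length
      of \<open>\<phi>'\<close>, and the positive factor \<open>n\<close> cancels.\<close>
    have k: "length \<phi> = k"
      using root \<phi> w n_pos by simp
    have "step M (subst \<phi> (lhs q a k)) (subst \<phi> w)"
      using w k u(3) \<phi>(1) by (intro step.rule) (auto dest: treesD(2))
    then show ?thesis
      using root_rewrite[OF w(3) k] root w \<phi> u k
      by (intro exI[of _ "subst \<phi> w"]) (simp add: subst_lhs)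
  next
    case (inner us t t' vs)
    then have "step M' (hom s) t'"
      by (auto simp: Cons_eq_append_conv)
    then show ?thesis
      using no_step_trees[OF hom_apply_copy_hom_trees[OF u(3)] _ top_down_M'] disjoint(1) by simp
  qed
next
  case (node a ts)
  have a: "a \<notin> states M"
    using node(1) disjoint(2) symbolsI by fast
  then have "step M' (Node a (map convert ts)) v'"
    using node.prems by simp
  then show ?case
  proof (cases rule: step_Node_cases)
    case (root b k w \<phi>)
    then show ?thesis
      using a top_downD(1)[OF top_down_M' root(2)] by simp
  next
    case (inner us' t1 t1' vs')
    \<comment> \<open>The conversion acts childwise here, so the position rewritten in the image
      marks a child \<open>t\<close> of the original node.\<close>
    then obtain us t vs where ts: "ts = us @ t # vs" "us' = map convert us" "t1 = convert t"
      "vs' = map convert vs"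
      by (auto simp: map_eq_append_conv map_eq_Cons_conv)
    then obtain t' where t': "t1' = convert t'" "step M t t'"
      using node.IH[of t t1'] inner by auto
    then have "step M (Node a ts) (Node a (us @ t' # vs))"
      using ts by (auto intro: step.ctxt)
    then show ?thesis
      using inner ts t' a by (intro exI[of _ "Node a (us @ t' # vs)"]) simp
  qed
qed

section \<open>Derivations and realized transformations\<close>

lemma steps_forward:
  assumes "(step M)\<^sup>*\<^sup>* u v" "u \<in> sentential"
  shows "v \<in> sentential \<and> (step M')\<^sup>*\<^sup>* (convert u) (convert v)"
  using assms
  by (induction rule: rtranclp_induct) (auto dest: step_forward intro: rtranclp.rtrancl_into_rtrancl)

lemma steps_backward:
  assumes "(step M')\<^sup>*\<^sup>* (convert u) v'" "u \<in> sentential"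
  shows "\<exists>v. v' = convert v \<and> (step M)\<^sup>*\<^sup>* u v"
  using assms(1)
proof (induction rule: rtranclp_induct)
  case (step v' w')
  then obtain v where v: "v' = convert v" "(step M)\<^sup>*\<^sup>* u v"
    by blast
  then have "v \<in> sentential"
    using steps_forward assms(2) by blast
  moreover have "step M' (convert v) w'"
    using step v by simp
  ultimately obtain w where "w' = convert w" "step M v w"
    using step_backward by blast
  with v show ?case
    by (auto intro: rtranclp.rtrancl_into_rtrancl)
qed auto

lemma realizes_iff:
  assumes "s \<in> trees (in_alph M)"
  shows "(s, t) \<in> realizes M \<longleftrightarrow> (hom s, t) \<in> realizes M'"
proof -
  have "(step M)\<^sup>*\<^sup>* (Node q [s]) t \<longleftrightarrow> (step M')\<^sup>*\<^sup>* (Node q [hom s]) t"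
    if q: "q \<in> initial M" and t: "t \<in> trees (out_alph M)" for q
  proof -
    have "q \<in> states M"
      using q top_down_M by (auto simp: top_down_def)
    then have sent: "Node q [s] \<in> sentential" and conv: "convert (Node q [s]) = Node q [hom s]"
      using assms by (auto simp: configs_def intro: trees_over.base)
    have "convert t = t"
      using t disjoint(2) below_states_trees by blast
    \<comment> \<open>Pulling back a derivation of \<open>M'\<close> only gives some
      \<open>v\<close> with image \<open>t\<close>; as \<open>t\<close> contains no state, neither
      does \<open>v\<close>, and the conversion fixes it.\<close>
    moreover have "v = t" if "(step M)\<^sup>*\<^sup>* (Node q [s]) v" "t = convert v" for v
    proof -
      have "v \<in> trees (out_alph M)"
        using that t sent steps_forward disjoint(2) trees_if_below_states_trees by metis
      then show "v = t"
        using that disjoint(2) below_states_trees by metis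
    qed
    ultimately show ?thesis
      using steps_forward[OF _ sent] steps_backward[OF _ sent] conv by metis
  qed
  then show ?thesis
    using assms hom_apply_copy_hom_trees by (auto simp: realizes_def)
qed

text \<open>Input trees of \<open>M'\<close> that are not of the form \<open>hom s\<close> do no
  harm, since the composition never feeds them to \<open>M'\<close>.\<close>

lemma realizes_factorization:
  "realizes M = {(s, hom s) | s. s \<in> trees (in_alph M)} O realizes M'"
  using realizes_iff by (auto simp: realizes_def[of M])

lemma hom_in_HOM: "{(s, hom s) | s. s \<in> trees (in_alph M)} \<in> HOM"
proof -
  have "ranked_alphabet (in_alph M)"
    using top_down_M by (simp add: top_down_def)
  then show ?thesis
    using tree_hom_copy_hom[of "in_alph M" n]
    unfolding HOM_def ranked_alphabet_def copy_alph_def by blast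
qed

end

lemma ex_copying:
  assumes "top_down M"
  shows "\<exists>n. copying M n"
proof -
  \<comment> \<open>The sum over the finitely many rules dominates each single count, and
    \<open>Suc\<close> makes the bound positive even if no variable occurs.\<close>
  let ?n = "Suc (\<Sum>r \<in> rules M. num_vars (snd r))"
  have "copying M ?n"
  proof
    fix v w
    assume "(v, w) \<in> rules M"
    then have "num_vars (snd (v, w)) \<le> (\<Sum>r \<in> rules M. num_vars (snd r))"
      using assms by (intro member_le_sum) (auto simp: top_down_def)
    then show "num_vars w \<le> ?n"
      by simp
  qed (use assms in simp_all)
  then show ?thesis ..
qed

theorem theorem4p64:
  "(class_T :: 'a transformation set) \<subseteq> HOM \<circ>\<^sub>c class_LT \<and>
   (class_DT :: 'a transformation set) \<subseteq> HOM \<circ>\<^sub>c class_LDT"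
proof (intro conjI subsetI)
  fix \<tau> :: "'a transformation"
  assume "\<tau> \<in> class_T"
  then obtain M where M: "top_down M" "\<tau> = realizes M"
    by (auto simp: class_T_def)
  then obtain n where "copying M n"
    using ex_copying by blast
  then interpret copying M n .
  have "realizes M' \<in> class_LT"
    using top_down_M' linear_M' by (auto simp: class_LT_def)
  then show "\<tau> \<in> HOM \<circ>\<^sub>c class_LT"
    unfolding class_comp_def M(2) using realizes_factorization hom_in_HOM by blast
next
  fix \<tau> :: "'a transformation"
  assume "\<tau> \<in> class_DT"
  then obtain M where M: "top_down M" "deterministic M" "\<tau> = realizes M"
    by (auto simp: class_DT_def)
  then obtain n where "copying M n"
    using ex_copying by blast
  then interpret copying M n .
  have "realizes M' \<in> class_LDT"
    using top_down_M' linear_M' deterministic_M'[OF M(2)] by (auto simp: class_LDT_def)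
  then show "\<tau> \<in> HOM \<circ>\<^sub>c class_LDT"
    unfolding class_comp_def M(3) using realizes_factorization hom_in_HOM by blast
qed

end
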